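(* Let $p$ and $r$ be odd primes such that $p$ is a primitive root modulo $r$. Then $$g\left(\frac{p^{r-1}-1}{2r},\,p^{r-1}\right)=\begin{cases}\left\lfloor \frac{pr}{4}-\frac{p}{4r}\right\rfloor & \text{if } r<p;\\[2pt] \left\lfloor \frac{pr}{4}-\frac{r}{4p}\right\rfloor & \text{if } r\ge p.\end{cases}$$
   Context: For a prime power $q$ and a positive integer $k$, the Waring function $g(k,q)$ is the maximal number of summands needed to express the elements of the finite field $\mathbb{F}_q$ as sums of $k$th powers; that is, $g(k,q)$ is the smallest positive integer $g$ such that every $a\in\mathbb{F}_q$ can be written as $a=\sum_{i=1}^{g}x_i^k$ with $x_1,\ldots,x_g\in\mathbb{F}_q$ (the $x_i$ may be zero). The assertion includes that such a $g$ exists. "$p$ is a primitive root modulo $r$" means that the class of $p$ generates $(\mathbb{Z}/r\mathbb{Z})^*$ (in particular $p\neq r$). *)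

theory Defs
  imports "HOL-Number_Theory.Number_Theory"
begin

definition all_sums_of_powers :: "'a::field itself \<Rightarrow> nat \<Rightarrow> nat \<Rightarrow> bool" where
  "all_sums_of_powers T k g \<longleftrightarrow> (\<forall>a::'a. \<exists>x::nat \<Rightarrow> 'a. a = (\<Sum>i=1..g. x i ^ k))"

text \<open>
  The Waring function \<open>g(k, q)\<close>; the finite field with \<open>q\<close> elements is given by a type \<open>'a\<close>
  with \<open>CARD('a) = q\<close>. The value is meaningful only if some number of summands suffices
  (otherwise \<open>LEAST\<close> is unspecified), so statements about it should also assert
  the existence of such a number.
\<close>
definition waring :: "'a::{field, finite} itself \<Rightarrow> nat \<Rightarrow> nat" where
  "waring T k = (LEAST g. g > 0 \<and> all_sums_of_powers T k g)"

end

theory Submission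
  imports Defs "HOL-Computational_Algebra.Polynomial"
begin

text \<open>
  The nonzero \<open>k\<close>-th powers form the group of \<open>2 r\<close>-th roots of unity, that is, they are the
  elements \<open>\<plusminus> \<zeta> ^ i\<close> for a primitive \<open>r\<close>-th root of unity \<open>\<zeta>\<close>. As \<open>p\<close> is a primitive root
  modulo \<open>r\<close>, the only relation between the powers \<open>\<zeta> ^ i\<close>, \<open>i < r\<close>, over the prime field is
  that their sum vanishes. So the number of summands needed for \<open>\<Sum>i<r. a i * \<zeta> ^ i\<close> is the minimum
  over \<open>c\<close> of \<open>W c = (\<Sum>i<r. \<parallel>a i - c\<parallel>)\<close>, where \<open>\<parallel>x\<parallel>\<close> (\<open>cyc_norm p x\<close>) is the distance of
  \<open>x\<close> from \<open>p\<int>\<close> and \<open>W\<close> is \<open>cyc_dist_sum p r a\<close>, and the Waring number is the largest median distance of \<open>r\<close> points on a cycle of length \<open>p\<close>.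

  Averaging \<open>W\<close> over the whole cycle bounds this minimum by \<open>r (p\<^sup>2 - 1) / (4 p)\<close>. Averaging
  over the points \<open>a i\<close> bounds it by \<open>p (r\<^sup>2 - 1) / (4 r)\<close>, because \<open>\<parallel>x - y\<parallel>\<close> counts the
  arcs of length \<open>(p - 1) / 2\<close> that contain \<open>x\<close> but not \<open>y\<close>, and an arc that contains \<open>N\<close> of the
  points contributes \<open>N (r - N)\<close>.

  Conversely, the identity \<open>2 \<parallel>x\<parallel> + \<parallel>x + h\<parallel> + \<parallel>x + h + 1\<parallel> = p - [x = 0]\<close> for \<open>p = 2 h + 1\<close> allows
  one to prescribe \<open>W\<close>: if a function \<open>f\<close> has the right total, then the multiplicities
  \<open>r p - 2 f c - f (c + h) - f (c + h + 1)\<close> give \<open>W = f\<close>, and \<open>f\<close> can be chosen to take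
  two adjacent values only. For \<open>r < p\<close> the same formula with \<open>p\<close> and \<open>r\<close> exchanged gives the gaps
  between consecutive points.
\<close>

section \<open>The cyclic norm\<close>

definition cyc_norm :: "nat \<Rightarrow> int \<Rightarrow> int" where
  "cyc_norm p x = min (x mod int p) (- x mod int p)"

lemma cyc_norm_cong: "x mod int p = y mod int p \<Longrightarrow> cyc_norm p x = cyc_norm p y"
  unfolding cyc_norm_def by (metis mod_minus_eq)

lemma cyc_norm_add_modulus [simp]: "cyc_norm p (x + int p) = cyc_norm p x"
  by (rule cyc_norm_cong) simp

lemma cyc_norm_minus [simp]: "cyc_norm p (- x) = cyc_norm p x"
  by (simp add: cyc_norm_def min.commute)

lemma cyc_norm_eq:
  assumes "p > 0"
  shows "cyc_norm p x = min (x mod int p) (int p - x mod int p)"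
proof -
  have "0 \<le> x mod int p" "x mod int p < int p" using assms by simp_all
  then show ?thesis
    unfolding cyc_norm_def zmod_zminus1_eq_if by auto
qed

lemma cyc_norm_0 [simp]: "cyc_norm p 0 = 0"
  by (simp add: cyc_norm_def)

lemma cyc_norm_small: "\<lbrakk>0 \<le> x; 2 * x \<le> int p\<rbrakk> \<Longrightarrow> cyc_norm p x = x"
  by (cases "p = 0") (auto simp: cyc_norm_eq)

lemma cyc_norm_large: "\<lbrakk>int p \<le> 2 * x; x \<le> int p\<rbrakk> \<Longrightarrow> cyc_norm p x = int p - x"
  using cyc_norm_small[of "int p - x" p] cyc_norm_add_modulus[of p "- x"] by simp

lemma cyc_norm_eq_min: "\<lbrakk>0 \<le> x; x \<le> int p\<rbrakk> \<Longrightarrow> cyc_norm p x = min x (int p - x)"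
  by (cases "2 * x \<le> int p") (simp_all add: cyc_norm_small cyc_norm_large)

lemma cyc_norm_le_abs: "p > 0 \<Longrightarrow> cyc_norm p x \<le> \<bar>x\<bar>"
  unfolding cyc_norm_def
  by (cases "x \<ge> 0") (auto simp: min_le_iff_disj zmod_le_nonneg_dividend)

text \<open>With \<open>cyc_norm_le_abs\<close>, the norm is the least absolute value in a residue
  class, hence the cost of one coefficient.\<close>

lemma cyc_norm_attained:
  assumes "p > 0"
  obtains y where "y mod int p = x mod int p" "\<bar>y\<bar> = cyc_norm p x"
proof (cases "x mod int p \<le> int p - x mod int p")
  case True
  then show ?thesis using assms that[of "x mod int p"] by (simp add: cyc_norm_eq)
next
  case False
  moreover have "x mod int p < int p" using assms by simp
  ultimately show ?thesis
    by (intro that[of "x mod int p - int p"]) (simp_all add: cyc_norm_eq assms abs_of_neg)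
qed

text \<open>On a continuous cycle the norms of \<open>x\<close> and of its antipode
  \<open>x + p / 2\<close> add up to \<open>p / 2\<close>. The antipode is the midpoint of
  \<open>x + h\<close> and \<open>x + h + 1\<close>, and the norm is linear between these unless its
  peak lies there, that is, unless \<open>x\<close> is 0 modulo \<open>p\<close>; this costs the
  1.\<close>

lemma cyc_norm_half_shift:
  assumes "p = 2 * h + 1"
  shows "2 * cyc_norm p x + cyc_norm p (x + int h) + cyc_norm p (x + int h + 1)
    = int p - of_bool (x mod int p = 0)"
proof -
  have p: "int p = 2 * int h + 1" using assms by simp
  have "p > 0" using assms by simp
  define y where "y = x mod int p"
  have y: "0 \<le> y" "y < int p" using \<open>p > 0\<close> by (simp_all only: y_def pos_mod_sign pos_mod_bound of_nat_0_less_iff)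
  have *: "cyc_norm p (x + d) = cyc_norm p (y + d)" for d
    by (rule cyc_norm_cong) (simp add: y_def mod_add_left_eq)
  have shift: "cyc_norm p z = cyc_norm p (z - int p)" for z
    by (rule cyc_norm_cong) simp
  have "2 * cyc_norm p y + cyc_norm p (y + int h) + cyc_norm p (y + (int h + 1))
      = int p - of_bool (y = 0)"
  proof (cases "y \<le> int h")
    case True
    then have "cyc_norm p (y + (int h + 1)) = int h - y" using p y by (simp add: cyc_norm_large)
    moreover have "cyc_norm p (y + int h) = (if y = 0 then int h else int h + 1 - y)"
      using True p y by (simp add: cyc_norm_small cyc_norm_large)
    ultimately show ?thesis using True p y by (simp add: cyc_norm_small)
  next
    case False
    have "cyc_norm p (y + int h) = y + int h - int p"
      using p False y by (subst shift) (simp add: cyc_norm_small)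
    moreover have "cyc_norm p (y + (int h + 1)) = y + int h + 1 - int p"
      using p False y by (subst shift) (simp add: cyc_norm_small)
    moreover have "cyc_norm p y = int p - y" using False y p by (intro cyc_norm_large) auto
    ultimately show ?thesis using False p by simp
  qed
  then have "2 * cyc_norm p x + cyc_norm p (x + int h) + cyc_norm p (x + int h + 1)
      = int p - of_bool (y = 0)"
    using *[of 0] *[of "int h"] *[of "int h + 1"] by (simp add: add.assoc)
  then show ?thesis by (simp only: y_def)
qed

text \<open>On one period the norm is the minimum of \<open>x\<close> and \<open>p - x\<close>, so
  it has convex kinks only at multiples of \<open>p\<close>.\<close>

lemma cyc_norm_concave:
  assumes "p > 0" "x mod int p \<noteq> 0"
  shows "cyc_norm p (x + 1) + cyc_norm p (x - 1) \<le> 2 * cyc_norm p x"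
proof -
  define y where "y = x mod int p"
  have "0 \<le> y" "y < int p" using assms by (simp_all add: y_def)
  moreover have "y \<noteq> 0" using assms by (simp add: y_def)
  ultimately have y: "0 < y" "y < int p" by simp_all
  have *: "cyc_norm p (x + d) = cyc_norm p (y + d)" for d
    by (rule cyc_norm_cong) (simp add: y_def mod_add_left_eq)
  have "cyc_norm p x = cyc_norm p y" "cyc_norm p (x + 1) = cyc_norm p (y + 1)"
    "cyc_norm p (x - 1) = cyc_norm p (y - 1)"
    using *[of 0] *[of 1] *[of "-1"] by simp_all
  moreover have "cyc_norm p z = min z (int p - z)" if "z \<in> {y - 1, y, y + 1}" for z
    using that y by (intro cyc_norm_eq_min) auto
  ultimately show ?thesis by (simp add: min_def)
qed

section \<open>Sums over a full period\<close>

lemma sum_mod_shift: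
  fixes f :: "int \<Rightarrow> 'a::ab_group_add"
  assumes "\<And>x. f (x + int p) = f x"
  shows "(\<Sum>u<p. f (t + int u)) = (\<Sum>u<p. f (int u))"
proof -
  have step: "(\<Sum>u<p. f (t + 1 + int u)) = (\<Sum>u<p. f (t + int u))" for t
  proof -
    have "f t + (\<Sum>u<p. f (t + 1 + int u)) = (\<Sum>u<Suc p. f (t + int u))"
      by (subst sum.lessThan_Suc_shift) (simp add: ac_simps)
    also have "\<dots> = (\<Sum>u<p. f (t + int u)) + f t" by (simp add: assms)
    finally show ?thesis by (simp add: add.commute)
  qed
  show ?thesis
  proof (induction t rule: int_induct[where k = 0])
    case (step2 i)
    then show ?case using step[of "i - 1"] by simp
  qed (simp_all add: step)
qed

lemma sum_mod_reflect:
  fixes f :: "int \<Rightarrow> 'a::ab_group_add"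
  assumes "\<And>x. f (x + int p) = f x"
  shows "(\<Sum>u<p. f (t - int u)) = (\<Sum>u<p. f (int u))"
proof -
  have "(\<Sum>u<p. f (t - int u)) = (\<Sum>u<p. f (t - int (p - Suc u)))"
    by (rule sum.nat_diff_reindex[symmetric])
  also have "\<dots> = (\<Sum>u<p. f ((t - int p + 1) + int u))"
    by (intro sum.cong refl arg_cong[of _ _ f]) auto
  finally show ?thesis using sum_mod_shift[of f p, OF assms] by simp
qed

text \<open>Summing \<open>cyc_norm_half_shift\<close> over a period gives four copies of the same
  sum.\<close>

lemma sum_cyc_norm:
  assumes "odd p"
  shows "4 * (\<Sum>c<p. cyc_norm p (x - int c)) = int p ^ 2 - 1"
proof -
  obtain h where p: "p = 2 * h + 1" using assms oddE by blast
  let ?S = "\<Sum>c<p. cyc_norm p (int c)"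
  have shift: "(\<Sum>c<p. cyc_norm p (t + int c)) = ?S" for t
    by (rule sum_mod_shift) simp
  have "(\<Sum>c<p. 2 * cyc_norm p (int c) + cyc_norm p (int h + int c)
      + cyc_norm p ((int h + 1) + int c)) = (\<Sum>c<p. int p - of_bool (c = 0))"
  proof (intro sum.cong refl)
    fix c assume "c \<in> {..<p}"
    then have "(int c mod int p = 0) = (c = 0)" by auto
    then show "2 * cyc_norm p (int c) + cyc_norm p (int h + int c)
        + cyc_norm p ((int h + 1) + int c) = int p - of_bool (c = 0)"
      using cyc_norm_half_shift[OF p, of "int c"] by (simp add: ac_simps)
  qed
  also have "\<dots> = int p ^ 2 - 1"
    using p by (simp add: sum_subtractf power2_eq_square of_bool_def)
  finally have "4 * ?S = int p ^ 2 - 1"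
    by (simp only: sum.distrib shift flip: sum_distrib_left)
  moreover have "(\<Sum>c<p. cyc_norm p (x - int c)) = ?S"
    by (rule sum_mod_reflect) simp
  ultimately show ?thesis by simp
qed

definition cyc_dist_sum :: "nat \<Rightarrow> nat \<Rightarrow> (nat \<Rightarrow> int) \<Rightarrow> int \<Rightarrow> int" where
  "cyc_dist_sum p r a c = (\<Sum>i<r. cyc_norm p (a i - c))"

lemma cyc_dist_sum_cong:
  "c mod int p = d mod int p \<Longrightarrow> cyc_dist_sum p r a c = cyc_dist_sum p r a d"
  unfolding cyc_dist_sum_def by (intro sum.cong refl cyc_norm_cong) (metis mod_diff_right_eq)

section \<open>Upper bounds for the cyclic median\<close>

lemma cyc_median_le_mean:
  assumes "odd p"
  shows "\<exists>c. 4 * int p * cyc_dist_sum p r a c \<le> int r * (int p ^ 2 - 1)"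
proof (rule ccontr)
  assume "\<not> ?thesis"
  then have less: "int r * (int p ^ 2 - 1) < 4 * int p * cyc_dist_sum p r a (int c)" for c
    by (simp add: not_le)
  have "p > 0" using assms by (rule odd_pos)
  have "int p * (int r * (int p ^ 2 - 1)) = (\<Sum>c<p. int r * (int p ^ 2 - 1))" by simp
  also have "\<dots> < (\<Sum>c<p. 4 * int p * cyc_dist_sum p r a (int c))"
    using less \<open>p > 0\<close> by (intro sum_strict_mono) auto
  also have "\<dots> = int p * (4 * (\<Sum>c<p. cyc_dist_sum p r a (int c)))"
    by (simp add: sum_distrib_left mult_ac)
  also have "4 * (\<Sum>c<p. cyc_dist_sum p r a (int c))
      = (\<Sum>i<r. 4 * (\<Sum>c<p. cyc_norm p (a i - int c)))"
    unfolding cyc_dist_sum_def by (subst sum.swap) (simp add: sum_distrib_left)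
  also have "\<dots> = int r * (int p ^ 2 - 1)"
    by (simp add: sum_cyc_norm[OF assms])
  finally show False by simp
qed

text \<open>\<open>u (x - k)\<close> indicates that \<open>x\<close> lies in the arc of
  \<open>h\<close> residues starting at \<open>k\<close>, so the sum counts the arcs that contain
  \<open>x\<close> but not \<open>y\<close>. Products of indicators decouple the two points.\<close>

lemma cyc_norm_half_intervals:
  fixes x y :: int
  assumes p: "p = 2 * h + 1"
  defines "u \<equiv> \<lambda>z. of_bool (z mod int p < int h) :: int"
  shows "(\<Sum>k<p. u (x - int k) * (1 - u (y - int k))) = cyc_norm p (x - y)"
proof -
  define d where "d = (x - y) mod int p"
  have d: "0 \<le> d" "d < int p" using p by (simp_all add: d_def)
  have per: "u (z + int p) = u z" for z by (simp add: u_def)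
  have cg: "u z = u z'" if "z mod int p = z' mod int p" for z z' by (simp add: u_def that)
  have "(\<Sum>k<p. u (x - int k) * (1 - u (y - int k)))
      = (\<Sum>k<p. u (x - int k) * (1 - u ((x - int k) - d)))"
    unfolding d_def
    by (intro sum.cong refl arg_cong2[of _ _ _ _ "(*)"] arg_cong2[of _ _ _ _ "(-)"] cg)
      (simp add: mod_diff_right_eq)
  also have "\<dots> = (\<Sum>k<p. u (int k) * (1 - u (int k - d)))"
    by (rule sum_mod_reflect[of "\<lambda>z. u z * (1 - u (z - d))"])
      (simp only: per flip: diff_add_eq)
  \<comment> \<open>Now \<open>k\<close> is the offset of \<open>x\<close> in the arc and
    \<open>k - d\<close> that of \<open>y\<close>. For \<open>k < h\<close>, the point
    \<open>y\<close> is outside exactly if \<open>k - d\<close> is negative and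
    \<open>k - d + p \<ge> h\<close>.\<close>
  also have "\<dots> = (\<Sum>k<p. of_bool (k < h \<and> (int k < d) \<and> d \<le> int h + 1 + int k))"
  proof (intro sum.cong refl)
    fix k assume "k \<in> {..<p}"
    then have k: "k < p" by simp
    have "u (int k) = of_bool (k < h)" using k by (simp add: u_def)
    moreover have "u (int k - d) = of_bool (\<not> (int k < d \<and> d \<le> int h + 1 + int k))"
      if "k < h"
    proof (cases "int k < d")
      case True
      have "(int k - d) mod int p = (int k - d + int p) mod int p" by simp
      also have "\<dots> = int k - d + int p" using True d k by (intro mod_pos_pos_trivial) auto
      finally show ?thesis using True p by (auto simp: u_def)
    next
      case False
      then have "(int k - d) mod int p = int k - d"
        using d k by (intro mod_pos_pos_trivial) auto
      then show ?thesis using False d that by (auto simp: u_def)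
    qed
    ultimately show "u (int k) * (1 - u (int k - d))
        = of_bool (k < h \<and> (int k < d) \<and> d \<le> int h + 1 + int k)" by auto
  qed
  also have "\<dots> = int (card {k. k < p \<and> k < h \<and> (int k < d) \<and> d \<le> int h + 1 + int k})"
    by (simp add: sum.If_cases of_bool_def Int_def lessThan_def)
  also have "{k. k < p \<and> k < h \<and> (int k < d) \<and> d \<le> int h + 1 + int k}
      = {nat (d - int h - 1)..<min h (nat d)}"
    using p d by auto
  also have "int (card \<dots>) = min d (int p - d)" using d p by auto
  also have "\<dots> = cyc_norm p (x - y)" using p by (simp add: cyc_norm_eq d_def)
  finally show ?thesis .
qed

lemma sum_cyc_norm_pairs_le:
  fixes a :: "nat \<Rightarrow> int"
  assumes "odd p" "odd r"
  shows "4 * (\<Sum>i<r. \<Sum>j<r. cyc_norm p (a i - a j)) \<le> int p * (int r ^ 2 - 1)"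
proof -
  obtain h where p: "p = 2 * h + 1" using \<open>odd p\<close> oddE by blast
  define u :: "int \<Rightarrow> int" where "u = (\<lambda>z. of_bool (z mod int p < int h))"
  define N where "N = (\<lambda>k. \<Sum>i<r. u (a i - int k))"
  have "(\<Sum>i<r. \<Sum>j<r. cyc_norm p (a i - a j))
      = (\<Sum>i<r. \<Sum>j<r. \<Sum>k<p. u (a i - int k) * (1 - u (a j - int k)))"
    unfolding u_def by (intro sum.cong refl cyc_norm_half_intervals[OF p, symmetric])
  also have "\<dots> = (\<Sum>i<r. \<Sum>k<p. \<Sum>j<r. u (a i - int k) * (1 - u (a j - int k)))"
    by (intro sum.cong refl sum.swap)
  also have "\<dots> = (\<Sum>k<p. \<Sum>i<r. \<Sum>j<r. u (a i - int k) * (1 - u (a j - int k)))"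
    by (rule sum.swap)
  also have "\<dots> = (\<Sum>k<p. N k * (int r - N k))"
    unfolding N_def by (simp add: sum_product[symmetric] sum_subtractf)
  finally have "4 * (\<Sum>i<r. \<Sum>j<r. cyc_norm p (a i - a j)) = (\<Sum>k<p. 4 * (N k * (int r - N k)))"
    by (simp add: sum_distrib_left)
  also have "\<dots> \<le> (\<Sum>k<p. int r ^ 2 - 1)"
  proof (intro sum_mono)
    fix k
    \<comment> \<open>As \<open>r\<close> is odd, the square of \<open>2 * N k - r\<close> is at
      least 1; this yields the \<open>- 1\<close> in the bound.\<close>
    have "odd (2 * N k - int r)" using \<open>odd r\<close> by simp
    then have "2 * N k - int r \<noteq> 0" by fastforce
    then have "(2 * N k - int r) ^ 2 > 0" by simp
    then show "4 * (N k * (int r - N k)) \<le> int r ^ 2 - 1"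
      by (simp add: power2_eq_square algebra_simps)
  qed
  finally show ?thesis by simp
qed

lemma cyc_median_le_mean_at_points:
  assumes "odd p" "odd r"
  shows "\<exists>c. 4 * int r * cyc_dist_sum p r a c \<le> int p * (int r ^ 2 - 1)"
proof (rule ccontr)
  assume "\<not> ?thesis"
  then have less: "int p * (int r ^ 2 - 1) < 4 * int r * cyc_dist_sum p r a c" for c
    by (simp add: not_le)
  have "r > 0" using assms by (simp add: odd_pos)
  have "int r * (int p * (int r ^ 2 - 1)) = (\<Sum>j<r. int p * (int r ^ 2 - 1))" by simp
  also have "\<dots> < (\<Sum>j<r. 4 * int r * cyc_dist_sum p r a (a j))"
    using less \<open>r > 0\<close> by (intro sum_strict_mono) auto
  also have "\<dots> = int r * (4 * (\<Sum>j<r. cyc_dist_sum p r a (a j)))"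
    by (simp add: sum_distrib_left mult_ac)
  also have "4 * (\<Sum>j<r. cyc_dist_sum p r a (a j))
      = 4 * (\<Sum>i<r. \<Sum>j<r. cyc_norm p (a i - a j))"
    unfolding cyc_dist_sum_def by (subst sum.swap) simp
  also have "int r * \<dots> \<le> int r * (int p * (int r ^ 2 - 1))"
    by (intro mult_left_mono sum_cyc_norm_pairs_le assms) simp
  finally show False by simp
qed

section \<open>Configurations with large cyclic median\<close>

text \<open>Take \<open>L\<close>, the average rounded down, and raise it to \<open>L + 1\<close> on
  as many residues as the exact total requires. The last inequality makes the multiplicities or gaps
  built from \<open>f\<close> nonnegative. The pair \<open>(m, n)\<close> will be
  \<open>(p, r)\<close> if \<open>p < r\<close> and \<open>(r, p)\<close> if
  \<open>r < p\<close>.\<close>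

lemma balanced_function_exists:
  fixes m n h :: nat
  assumes m: "m = 2 * h + 1" and "odd n" "m < n"
  defines "L \<equiv> int n * (int m ^ 2 - 1) div (4 * int m)"
  obtains f :: "int \<Rightarrow> int" where
    "\<And>c. f (c + int m) = f c" "\<And>c. L \<le> f c"
    "4 * (\<Sum>c<m. f (int c)) = int n * (int m ^ 2 - 1)"
    "\<And>c. 2 * (f c + f (c + int h)) \<le> int n * int m - 1"
proof -
  define T where "T = int n * (int h * (int h + 1))"
  have T: "int n * (int m ^ 2 - 1) = 4 * T"
    by (simp add: T_def m power2_eq_square algebra_simps)
  have L: "L = T div int m" unfolding L_def T by simp
  define R where "R = T mod int m"
  have TR: "T = int m * L + R" by (simp add: L R_def)
  have R: "0 \<le> R" "R < int m" using m by (simp_all add: R_def)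
  define f where "f = (\<lambda>c. L + of_bool (c mod int m < R))"
  \<comment> \<open>The last inequality is immediate if \<open>G \<ge> 5\<close>; if
    \<open>G = 3\<close>, it holds unless both values are \<open>L + 1\<close>. As \<open>G\<close>
    is odd and, by \<open>m < n\<close>, exceeds 1, these cases suffice.\<close>
  define G where "G = int n * int m - 4 * L"
  have "int m * G = int n * int m ^ 2 - 4 * (T - R)"
    by (simp add: G_def TR algebra_simps power2_eq_square)
  also have "\<dots> = int n + 4 * R" using T by (simp add: algebra_simps)
  finally have mG: "int m * G = int n + 4 * R" .
  have "G > 1"
  proof (rule ccontr)
    assume "\<not> G > 1"
    then have "int m * G \<le> int m * 1" using m by (intro mult_left_mono) auto
    then show False using mG R \<open>m < n\<close> by simp
  qed
  moreover have "odd G" using \<open>odd n\<close> m by (simp add: G_def)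
  ultimately have G: "G = 3 \<or> G \<ge> 5" by presburger
  show thesis
  proof (rule that[of f])
    show "f (c + int m) = f c" "L \<le> f c" for c by (simp_all add: f_def)
    have "(\<Sum>c<m. f (int c)) = int m * L + (\<Sum>c<m. of_bool (int c < R))"
      by (simp add: f_def sum.distrib)
    also have "(\<Sum>c<m. of_bool (int c < R)) = int (card {c. c < m \<and> int c < R})"
      by (simp add: sum.If_cases of_bool_def Int_def lessThan_def)
    also have "{c. c < m \<and> int c < R} = {..<nat R}" using R by auto
    finally show "4 * (\<Sum>c<m. f (int c)) = int n * (int m ^ 2 - 1)"
      using R T by (simp add: TR)
    show "2 * (f c + f (c + int h)) \<le> int n * int m - 1" for c
    proof (cases "G = 3")
      case True
      have "R \<le> int h" using mG True \<open>m < n\<close> m by simp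
      \<comment> \<open>The raised residues are \<open>0, ..., R - 1\<close> with
        \<open>R \<le> h\<close>, so a shift by \<open>h\<close> moves each of them out of this
        range.\<close>
      have "\<not> (c mod int m < R \<and> (c + int h) mod int m < R)"
      proof
        assume A: "c mod int m < R \<and> (c + int h) mod int m < R"
        have "0 \<le> c mod int m" using m by simp
        then have "(c mod int m + int h) mod int m = c mod int m + int h"
          using A R \<open>R \<le> int h\<close> m by (intro mod_pos_pos_trivial) auto
        then have "(c + int h) mod int m = c mod int m + int h"
          by (simp add: mod_add_left_eq)
        then show False using A \<open>R \<le> int h\<close> \<open>0 \<le> c mod int m\<close> by simp
      qed
      then show ?thesis using True by (auto simp: f_def G_def)
    next
      case False
      then show ?thesis using G by (auto simp: f_def G_def of_bool_def)
    qed
  qed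
qed

section \<open>Many points on a short cycle: the case \<open>p < r\<close>\<close>

lemma points_with_multiplicities:
  fixes w :: "nat \<Rightarrow> nat"
  assumes "(\<Sum>c<p. w c) = r"
  obtains a :: "nat \<Rightarrow> nat" where
    "\<And>\<phi> :: nat \<Rightarrow> int. (\<Sum>i<r. \<phi> (a i)) = (\<Sum>c<p. int (w c) * \<phi> c)"
proof -
  have "\<exists>a::nat \<Rightarrow> nat. \<forall>\<phi> :: nat \<Rightarrow> int.
      (\<Sum>i<(\<Sum>c<p. w c). \<phi> (a i)) = (\<Sum>c<p. int (w c) * \<phi> c)"
  proof (induction p)
    case (Suc p)
    then obtain a :: "nat \<Rightarrow> nat" where a: "\<And>\<phi> :: nat \<Rightarrow> int.
      (\<Sum>i<(\<Sum>c<p. w c). \<phi> (a i)) = (\<Sum>c<p. int (w c) * \<phi> c)" by blast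
    let ?n = "\<Sum>c<p. w c"
    define b where "b = (\<lambda>i. if i < ?n then a i else p)"
    have "(\<Sum>i<?n + k. \<phi> (b i)) = (\<Sum>i<?n. \<phi> (a i)) + int k * \<phi> p"
      for k and \<phi> :: "nat \<Rightarrow> int"
      by (induction k) (simp_all add: b_def algebra_simps)
    then show ?case using a by (intro exI[of _ b]) simp
  qed auto
  then show thesis using that assms by blast
qed

text \<open>The distance sum is a convolution of the multiplicities \<open>w\<close> with the norm.
  Moving the shifts by \<open>h\<close> and \<open>h + 1\<close> from \<open>f\<close> to the norm,
  \<open>cyc_norm_half_shift\<close> leaves a constant plus \<open>f c\<close>. The total of
  \<open>f\<close> makes the constant 0, so the distance sum is exactly \<open>f\<close>.\<close>

lemma cyc_dist_sum_lower_more_points: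
  assumes "odd p" "odd r" "p < r"
  obtains a :: "nat \<Rightarrow> int"
  where "\<And>c. int r * (int p ^ 2 - 1) div (4 * int p) \<le> cyc_dist_sum p r a c"
proof -
  obtain h where p: "p = 2 * h + 1" using \<open>odd p\<close> oddE by blast
  obtain f :: "int \<Rightarrow> int" where per: "\<And>c. f (c + int p) = f c"
    and ge: "\<And>c. int r * (int p ^ 2 - 1) div (4 * int p) \<le> f c"
    and tot: "4 * (\<Sum>c<p. f (int c)) = int r * (int p ^ 2 - 1)"
    and bound: "\<And>c. 2 * (f c + f (c + int h)) \<le> int r * int p - 1"
    using balanced_function_exists[OF p \<open>odd r\<close> \<open>p < r\<close>] by metis
  define w where "w = (\<lambda>c. int r * int p - 2 * f c - f (c + int h) - f (c + int h + 1))"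
  \<comment> \<open>Half the sum of the bounds at \<open>c\<close> and at \<open>c + h + 1\<close>,
    as \<open>c + h + 1 + h\<close> is \<open>c\<close> modulo \<open>p\<close>.\<close>
  have w_nonneg: "w c \<ge> 0" for c
  proof -
    have "f (c + int h + 1 + int h) = f c"
      using per[of c] p by (simp add: algebra_simps)
    then show ?thesis using bound[of c] bound[of "c + int h + 1"] by (simp add: w_def)
  qed
  have shift: "(\<Sum>c<p. g (int c + t)) = (\<Sum>c<p. g (int c))"
    if "\<And>x. g (x + int p) = g x" for g :: "int \<Rightarrow> int" and t
    using sum_mod_shift[of g p t, OF that] by (simp add: add.commute)
  have "(\<Sum>c<p. w (int c)) = int p * (int r * int p) - 4 * (\<Sum>c<p. f (int c))"
    unfolding w_def
    by (simp add: sum_subtractf shift per add.assoc flip: sum_distrib_left)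
  also have "\<dots> = int r" unfolding tot by (simp add: power2_eq_square algebra_simps)
  finally have "int (\<Sum>c<p. nat (w (int c))) = int r"
    using w_nonneg by simp
  then have "(\<Sum>c<p. nat (w (int c))) = r" by linarith
  then obtain a :: "nat \<Rightarrow> nat" where a: "\<And>\<phi> :: nat \<Rightarrow> int.
      (\<Sum>i<r. \<phi> (a i)) = (\<Sum>c<p. int (nat (w (int c))) * \<phi> c)"
    using points_with_multiplicities by metis
  show thesis
  proof (rule that)
    fix c :: int
    let ?n = "\<lambda>x. cyc_norm p (x - c)"
    have n_per: "?n (x + int p) = ?n x" for x
      using cyc_norm_add_modulus[of p "x - c"] by (simp add: algebra_simps)
    have norm_sum: "4 * (\<Sum>x<p. ?n (int x)) = int p ^ 2 - 1"
      using sum_cyc_norm[OF \<open>odd p\<close>, of c] by (metis (no_types, lifting) cyc_norm_minus minus_diff_eq sum.cong)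
    have conv: "(\<Sum>x<p. f (int x + t) * ?n (int x)) = (\<Sum>x<p. f (int x) * ?n (int x - t))" for t
    proof -
      have "f (x + int p) * ?n (x + int p - t) = f x * ?n (x - t)" for x
        using n_per[of "x - t"] by (simp add: per algebra_simps)
      from shift[of "\<lambda>x. f x * ?n (x - t)" t, OF this] show ?thesis by simp
    qed
    have "cyc_dist_sum p r (\<lambda>i. int (a i)) c = (\<Sum>x<p. w (int x) * ?n (int x))"
      unfolding cyc_dist_sum_def using a[of "\<lambda>x. ?n (int x)"] w_nonneg by simp
    also have "\<dots> = int r * int p * (\<Sum>x<p. ?n (int x)) - (2 * (\<Sum>x<p. f (int x) * ?n (int x))
        + (\<Sum>x<p. f (int x + int h) * ?n (int x)) + (\<Sum>x<p. f (int x + (int h + 1)) * ?n (int x)))"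
      unfolding w_def by (simp add: algebra_simps sum.distrib sum_subtractf sum_distrib_left)
    also have "2 * (\<Sum>x<p. f (int x) * ?n (int x))
        + (\<Sum>x<p. f (int x + int h) * ?n (int x)) + (\<Sum>x<p. f (int x + (int h + 1)) * ?n (int x))
        = (\<Sum>x<p. f (int x) * (2 * ?n (int x) + ?n (int x - int h) + ?n (int x - (int h + 1))))"
      unfolding conv by (simp add: algebra_simps sum.distrib sum_distrib_left)
    also have "\<dots> = (\<Sum>x<p. f (int x) * (int p - of_bool ((int x - c) mod int p = 0)))"
    proof (intro sum.cong refl arg_cong2[of _ _ _ _ "(*)"])
      fix x
      have "?n (int x - int h) = cyc_norm p (int x - c + int h + 1)"
        "?n (int x - (int h + 1)) = cyc_norm p (int x - c + int h)"
        using cyc_norm_add_modulus[of p "int x - int h - c"]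
          cyc_norm_add_modulus[of p "int x - (int h + 1) - c"] p
        by (simp_all add: algebra_simps)
      then show "2 * ?n (int x) + ?n (int x - int h) + ?n (int x - (int h + 1))
          = int p - of_bool ((int x - c) mod int p = 0)"
        using cyc_norm_half_shift[OF p, of "int x - c"] by simp
    qed
    also have "\<dots> = int p * (\<Sum>x<p. f (int x)) - (\<Sum>x<p. f (int x) * of_bool ((int x - c) mod int p = 0))"
      by (simp add: algebra_simps sum_subtractf sum_distrib_left)
    also have "(\<Sum>x<p. f (int x) * of_bool ((int x - c) mod int p = 0)) = f c"
    proof -
      have "(\<Sum>x<p. f (int x) * of_bool ((int x - c) mod int p = 0))
          = (\<Sum>x<p. f (c + int x) * of_bool (int x mod int p = 0))"
      proof -
        have "f (x + int p) * of_bool ((x + int p - c) mod int p = 0)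
            = f x * of_bool ((x - c) mod int p = 0)" for x
          unfolding per diff_add_eq[symmetric] mod_add_self2 ..
        from shift[of "\<lambda>x. f x * of_bool ((x - c) mod int p = 0)" c, OF this]
        show ?thesis by (simp add: add.commute)
      qed
      also have "\<dots> = (\<Sum>x<p. if x = 0 then f c else 0)"
        by (intro sum.cong refl) (auto simp: zmod_int[symmetric])
      finally show ?thesis using p by simp
    qed
    finally have "4 * cyc_dist_sum p r (\<lambda>i. int (a i)) c
        = int r * int p * (4 * (\<Sum>x<p. ?n (int x))) - int p * (4 * (\<Sum>x<p. f (int x))) + 4 * f c"
      by simp
    then have "cyc_dist_sum p r (\<lambda>i. int (a i)) c = f c"
      unfolding tot norm_sum by simp
    then show "int r * (int p ^ 2 - 1) div (4 * int p) \<le> cyc_dist_sum p r (\<lambda>i. int (a i)) c"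
      using ge by simp
  qed
qed

section \<open>Few points on a long cycle: the case \<open>r < p\<close>\<close>

text \<open>Between consecutive points the distance sum is concave, so it is minimal at a point.\<close>
lemma cyc_dist_sum_ge_if_ge_at_points:
  assumes "p > 0" "r > 0" and ge: "\<And>i. i < r \<Longrightarrow> M \<le> cyc_dist_sum p r a (a i)"
  shows "M \<le> cyc_dist_sum p r a c"
proof (rule ccontr)
  let ?W = "cyc_dist_sum p r a"
  assume "\<not> M \<le> ?W c"
  have nonneg: "?W x \<ge> 0" for x
    unfolding cyc_dist_sum_def using \<open>p > 0\<close> by (intro sum_nonneg) (simp add: cyc_norm_def)
  obtain d where d: "\<And>x. ?W d \<le> ?W x"
    using ex_has_least_nat[of "\<lambda>_. True" c "\<lambda>x. nat (?W x)"] nonneg by (auto simp: nat_le_eq_zle)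
  \<comment> \<open>A minimum below \<open>M\<close> is not attained at a point. By concavity, the
    successor of a minimal position that is not a point is minimal too, so the minimum would spread
    around the cycle and reach \<open>a 0\<close>.\<close>
  have "?W (d + int k) = ?W d" for k
  proof (induction k)
    case (Suc k)
    let ?c = "d + int k"
    have "(a i - ?c) mod int p \<noteq> 0" if "i < r" for i
    proof
      assume "(a i - ?c) mod int p = 0"
      then have "a i mod int p = ?c mod int p" by (metis mod_eq_dvd_iff mod_0_imp_dvd)
      then have "?W (a i) = ?W ?c" by (rule cyc_dist_sum_cong)
      then show False using ge[OF that] Suc.IH d[of c] \<open>\<not> M \<le> ?W c\<close> by simp
    qed
    then have "(\<Sum>i<r. cyc_norm p (a i - ?c + 1) + cyc_norm p (a i - ?c - 1))
        \<le> (\<Sum>i<r. 2 * cyc_norm p (a i - ?c))"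
      by (intro sum_mono cyc_norm_concave \<open>p > 0\<close>) auto
    then have "?W (?c - 1) + ?W (?c + 1) \<le> 2 * ?W ?c"
      by (simp add: cyc_dist_sum_def sum.distrib sum_distrib_left algebra_simps)
    then show ?case using Suc.IH d[of "?c - 1"] d[of "?c + 1"] by (simp add: algebra_simps)
  qed simp
  from this[of "nat ((a 0 - d) mod int p)"] have "?W (d + (a 0 - d) mod int p) = ?W d"
    using \<open>p > 0\<close> by simp
  moreover have "?W (d + (a 0 - d) mod int p) = ?W (a 0)"
    by (rule cyc_dist_sum_cong) (simp add: mod_add_right_eq)
  ultimately show False using ge[of 0] d[of c] \<open>r > 0\<close> \<open>\<not> M \<le> ?W c\<close> by simp
qed

text \<open>Here \<open>f\<close> prescribes the distance sums at the points, and \<open>g\<close>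
  gives the gaps between consecutive points. The gaps add up to \<open>p\<close>, and
  \<open>s\<close> successive gaps cover less than half the cycle, so distances are arc lengths and
  the sum at \<open>a i\<close> becomes \<open>f (i + s)\<close>. Concavity covers the positions in
  between.\<close>

lemma cyc_dist_sum_lower_fewer_points:
  assumes "odd p" "odd r" "r < p"
  obtains a :: "nat \<Rightarrow> int"
  where "\<And>c. int p * (int r ^ 2 - 1) div (4 * int r) \<le> cyc_dist_sum p r a c"
proof -
  obtain s where r: "r = 2 * s + 1" using \<open>odd r\<close> oddE by blast
  obtain f :: "int \<Rightarrow> int" where per: "\<And>c. f (c + int r) = f c"
    and ge: "\<And>c. int p * (int r ^ 2 - 1) div (4 * int r) \<le> f c"
    and tot: "4 * (\<Sum>c<r. f (int c)) = int p * (int r ^ 2 - 1)"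
    and bound: "\<And>c. 2 * (f c + f (c + int s)) \<le> int p * int r - 1"
    using balanced_function_exists[OF r \<open>odd p\<close> \<open>r < p\<close>] by metis
  define T where "T = (\<Sum>c<r. f (int c))"
  have r': "r = Suc (s + s)" using r by simp
  have T: "T = int p * (int s * (int s + 1))"
    using tot r by (simp add: T_def power2_eq_square algebra_simps)
  have T_shift: "(\<Sum>u<r. f (t + int u)) = T" for t
    unfolding T_def by (rule sum_mod_shift) (rule per)
  define g where "g = (\<lambda>c. int p * int r - 2 * f c - f (c + int s) - f (c + int s + 1))"
  have g_nonneg: "g c \<ge> 0" for c
  proof -
    have "f (c + int s + 1 + int s) = f c"
      using per[of c] r by (simp add: algebra_simps)
    then show ?thesis using bound[of c] bound[of "c + int s + 1"] by (simp add: g_def)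
  qed
  define a where "a = (\<lambda>n. \<Sum>t<n. g (int t))"
  have a_mono: "a m \<le> a n" if "m \<le> n" for m n
    unfolding a_def using that g_nonneg by (intro sum_mono2) auto
  have a_add: "a (i + j) - a i = (\<Sum>u<j. g (int i + int u))" for i j
    by (induction j) (simp_all add: a_def)
  have halves: "(\<Sum>u<s. f (t + int u)) + (\<Sum>u<s. f (t + int s + int u)) + f (t + 2 * int s) = T" for t
  proof -
    have "(\<Sum>u<s + k. f (t + int u)) = (\<Sum>u<s. f (t + int u)) + (\<Sum>u<k. f (t + int s + int u))" for k
      by (induction k) (simp_all add: algebra_simps)
    from this[of s] show ?thesis using T_shift[of t] by (simp add: r' add.assoc)
  qed
  have sum_g: "(\<Sum>u<k. g (t + int u)) = int k * (int p * int r) - 2 * (\<Sum>u<k. f (t + int u))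
      - (\<Sum>u<k. f (t + int s + int u)) - (\<Sum>u<k. f (t + int s + 1 + int u))" for k t
    by (induction k) (simp_all add: g_def algebra_simps)
  have arc: "a (i + s) - a i = f (int i + int s) + f (int i + 2 * int s) - int p * int s" for i
  proof -
    let ?F = "\<lambda>t. \<Sum>u<s. f (t + int u)"
    have "f (int i + int s) + ?F (int i + int s + 1) = ?F (int i + int s) + f (int i + 2 * int s)"
    proof -
      have "(\<Sum>u<Suc s. f (int i + int s + int u)) = f (int i + int s) + ?F (int i + int s + 1)"
        by (subst sum.lessThan_Suc_shift) (simp add: algebra_simps)
      then show ?thesis by (simp add: algebra_simps)
    qed
    moreover have "a (i + s) - a i = int s * (int p * int r) - 2 * ?F (int i)
        - ?F (int i + int s) - ?F (int i + int s + 1)"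
      unfolding a_add sum_g ..
    ultimately have "a (i + s) - a i = int s * (int p * int r) - 2 * T
        + f (int i + int s) + f (int i + 2 * int s)"
      using halves[of "int i"] by simp
    then show ?thesis using r by (simp add: T algebra_simps)
  qed
  \<comment> \<open>The bound on two values of \<open>f\<close> at distance \<open>s\<close> says
    exactly that \<open>s\<close> gaps span less than half the cycle.\<close>
  have arc_le: "2 * (a (i + s) - a i) < int p" for i
    using bound[of "int i + int s"] r by (simp add: arc algebra_simps)
  have a_r: "a (i + r) = a i + int p" for i
  proof -
    have "(\<Sum>u<r. g (int i + int u)) = int r * (int p * int r) - 4 * T"
      unfolding sum_g T_shift by simp
    also have "\<dots> = int p" using tot by (simp add: T_def power2_eq_square algebra_simps)
    finally show ?thesis using a_add[of i r] by simp
  qed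
  have at_points: "cyc_dist_sum p r a (a i) = f (int i + int s)" for i
  proof -
    let ?n = "\<lambda>j. cyc_norm p (a j - a i)"
    have n_per: "?n (j + r) = ?n j" for j
      using cyc_norm_add_modulus[of p "a j - a i"] by (simp add: a_r algebra_simps)
    have "(\<Sum>j<r. ?n (k + j)) = (\<Sum>j<r. ?n j)" for k
    proof (induction k)
      case (Suc k)
      have "?n k + (\<Sum>j<r. ?n (Suc k + j)) = (\<Sum>j<Suc r. ?n (k + j))"
        by (subst sum.lessThan_Suc_shift) simp
      then show ?case using Suc by (simp add: n_per)
    qed simp
    then have "cyc_dist_sum p r a (a i) = (\<Sum>j<r. ?n (i + j))"
      by (simp add: cyc_dist_sum_def)
    \<comment> \<open>Seen from \<open>a i\<close>, there are \<open>s\<close> points ahead and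
      \<open>s\<close> behind; the latter are measured back from \<open>a (i + r)\<close>, which is
      \<open>a i\<close> one turn later.\<close>
    also have "\<dots> = ?n i + (\<Sum>j<s. ?n (i + Suc j)) + (\<Sum>j<s. ?n (i + (s + Suc j)))"
    proof -
      have "(\<Sum>j<s + k. ?n (i + Suc j))
          = (\<Sum>j<s. ?n (i + Suc j)) + (\<Sum>j<k. ?n (i + (s + Suc j)))" for k
        by (induction k) simp_all
      moreover have "(\<Sum>j<Suc (s + k). ?n (i + j)) = ?n i + (\<Sum>j<s + k. ?n (i + Suc j))" for k
        by (subst sum.lessThan_Suc_shift) simp
      ultimately have "(\<Sum>j<Suc (s + k). ?n (i + j))
          = ?n i + (\<Sum>j<s. ?n (i + Suc j)) + (\<Sum>j<k. ?n (i + (s + Suc j)))" for k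
        by (simp only: add.assoc)
      from this[of s] show ?thesis by (simp only: r')
    qed
    also have "(\<Sum>j<s. ?n (i + Suc j)) = (\<Sum>j<s. a (i + Suc j) - a i)"
    proof (intro sum.cong refl)
      fix j assume "j \<in> {..<s}"
      then show "?n (i + Suc j) = a (i + Suc j) - a i"
        using arc_le[of i] a_mono[of "i + Suc j" "i + s"] a_mono[of i "i + Suc j"]
        by (intro cyc_norm_small) auto
    qed
    also have "(\<Sum>j<s. ?n (i + (s + Suc j))) = (\<Sum>j<s. a (i + r) - a (i + (s + Suc j)))"
    proof (intro sum.cong refl)
      fix j assume "j \<in> {..<s}"
      then have "cyc_norm p (a (i + r) - a (i + (s + Suc j))) = a (i + r) - a (i + (s + Suc j))"
        using arc_le[of "i + (s + 1)"] a_mono[of "i + (s + 1)" "i + (s + Suc j)"]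
          a_mono[of "i + (s + Suc j)" "i + r"]
        by (intro cyc_norm_small) (auto simp: r' add.assoc)
      moreover have "a (i + r) - a (i + (s + Suc j)) = - (a (i + (s + Suc j)) - a i) + int p"
        by (simp add: a_r)
      ultimately show "?n (i + (s + Suc j)) = a (i + r) - a (i + (s + Suc j))"
        by (simp only: cyc_norm_add_modulus cyc_norm_minus)
    qed
    \<comment> \<open>Pairing \<open>i + Suc j\<close> with \<open>i + (s + Suc j)\<close> leaves
      the complement of one arc of \<open>s\<close> gaps, to which \<open>arc\<close>
      applies.\<close>
    also have "?n i + (\<Sum>j<s. a (i + Suc j) - a i) + (\<Sum>j<s. a (i + r) - a (i + (s + Suc j)))
        = (\<Sum>j<s. int p - (a (i + Suc j + s) - a (i + Suc j)))"
      by (simp add: a_r sum.distrib sum_subtractf cyc_norm_small algebra_simps)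
    also have "\<dots> = (\<Sum>j<s. int p * (int s + 1) - f (int i + int s + 1 + int j)
        - f (int i + int s + 1 + int s + int j))"
      unfolding arc by (simp add: algebra_simps)
    also have "\<dots> = int s * (int p * (int s + 1)) - (T - f (int i + int s + 1 + 2 * int s))"
      using halves[of "int i + int s + 1"] by (simp add: sum_subtractf)
    also have "\<dots> = f (int i + int s)"
      using per[of "int i + int s"] r by (simp add: T algebra_simps)
    finally show ?thesis .
  qed
  show thesis
  proof (rule that)
    show "int p * (int r ^ 2 - 1) div (4 * int r) \<le> cyc_dist_sum p r a c" for c
      by (rule cyc_dist_sum_ge_if_ge_at_points) (use assms in \<open>simp_all add: at_points ge odd_pos\<close>)
  qed
qed

section \<open>Powers in finite fields\<close>

lemma CHAR_eq_of_card_prime_power: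
  assumes "prime p" "card (UNIV :: 'a::{field, finite} set) = p ^ n"
  shows "CHAR('a) = p"
proof -
  have "CHAR('a) > 0" by (rule finite_imp_CHAR_pos) simp
  then have "prime CHAR('a)" by (rule prime_CHAR_semidom)
  moreover have "CHAR('a) dvd p ^ n" using CHAR_dvd_CARD[where ?'a = 'a] assms(2) by simp
  ultimately show ?thesis using assms(1) by (metis prime_dvd_power primes_dvd_imp_eq)
qed

lemma power_card_minus_one_eq_one:
  fixes x :: "'a::{field, finite}"
  assumes "x \<noteq> 0"
  shows "x ^ (card (UNIV :: 'a set) - 1) = 1"
proof -
  have "(\<Prod>y\<in>UNIV - {0}. x * y) = (\<Prod>y\<in>UNIV - {0}. y)"
    by (rule prod.reindex_bij_witness[of _ "\<lambda>y. y / x" "\<lambda>y. x * y"]) (use assms in auto)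
  then have "x ^ (card (UNIV :: 'a set) - 1) * \<Prod>(UNIV - {0}) = \<Prod>(UNIV - {0})"
    by (simp add: prod.distrib)
  then show ?thesis by simp
qed

lemma card_nth_roots_le:
  fixes c :: "'a::field"
  assumes "n > 0"
  shows "card {x. x ^ n = c} \<le> n"
proof -
  let ?P = "Polynomial.monom 1 n - [:c:]"
  have "Polynomial.coeff ?P n = 1" using assms by (simp add: coeff_pCons split: nat.split)
  then have "?P \<noteq> 0" by (metis coeff_0 zero_neq_one)
  then have "card {x. poly ?P x = 0} \<le> Polynomial.degree ?P" by (rule card_poly_roots_bound)
  also have "\<dots> \<le> n" by (intro degree_diff_le) (simp_all add: degree_monom_le)
  finally show ?thesis by (simp add: poly_monom)
qed

text \<open>Each fibre of the \<open>k\<close>-th power map has at most \<open>k\<close> elements,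
  so there are at least \<open>m\<close> nonzero powers; they all solve \<open>z ^ m = 1\<close>,
  which has at most \<open>m\<close> solutions.\<close>

lemma finite_field_powers:
  fixes k m :: nat
  assumes "card (UNIV :: 'a::{field, finite} set) - 1 = m * k" "m > 0" "k > 0"
  shows "(\<lambda>x :: 'a. x ^ k) ` (UNIV - {0}) = {z. z ^ m = 1}" (is "?I = ?R")
    and "card {z :: 'a. z ^ m = 1} = m"
proof -
  have sub: "?I \<subseteq> ?R"
    using power_card_minus_one_eq_one[where ?'a = 'a] assms(1)
    by (auto simp: power_mult[symmetric] mult.commute)
  have "(\<Union>y\<in>?I. {x :: 'a. x ^ k = y} - {0}) = UNIV - {0}" by auto
  then have "m * k = card (\<Union>y\<in>?I. {x :: 'a. x ^ k = y} - {0})"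
    by (simp add: assms(1)[symmetric] card_Diff_singleton)
  also have "\<dots> \<le> (\<Sum>y\<in>?I. card ({x :: 'a. x ^ k = y} - {0}))"
    by (rule card_UN_le) simp
  also have "\<dots> \<le> (\<Sum>y\<in>?I. k)"
    by (intro sum_mono order_trans[OF card_mono card_nth_roots_le] assms) auto
  finally have "m * k \<le> card ?I * k" by simp
  then have "m \<le> card ?I" using assms by simp
  moreover have "card ?R \<le> m" by (rule card_nth_roots_le) fact
  moreover have "card ?I \<le> card ?R" using sub by (intro card_mono) auto
  ultimately have "card ?I = card ?R" "card ?R = m" by simp_all
  then show "?I = ?R" "card ?R = m" using sub by (simp_all add: card_subset_eq)
qed

lemma power_mod_exponent:
  fixes z :: "'a::monoid_mult"
  assumes "z ^ r = 1"
  shows "z ^ n = z ^ (n mod r)"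
proof -
  have "z ^ n = z ^ (r * (n div r) + n mod r)" by simp
  then show ?thesis using assms by (simp only: power_add power_mult power_one mult_1_left)
qed

lemma nontrivial_root_power_eq_one:
  fixes z :: "'a::monoid_mult"
  assumes "prime r" "z ^ r = 1" "z \<noteq> 1" "z ^ n = 1"
  shows "r dvd n"
proof (rule ccontr)
  assume "\<not> r dvd n"
  then have "coprime n r" using \<open>prime r\<close> by (metis coprime_commute prime_imp_coprime)
  then obtain x where "[n * x = 1] (mod r)" by (metis cong_solve_coprime_nat One_nat_def)
  then have "n * x mod r = 1" using prime_gt_1_nat[OF \<open>prime r\<close>] by (simp add: cong_def)
  then have "z ^ (n * x) = z" using power_mod_exponent[OF \<open>z ^ r = 1\<close>, of "n * x"] by simp
  then show False using assms by (simp add: power_mult)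
qed

text \<open>An integer in the field is a sum of ones, and Frobenius is additive.\<close>

lemma of_int_power_CHAR_power:
  fixes x :: int
  assumes "prime CHAR('a::comm_ring_1)"
  shows "(of_int x :: 'a) ^ (CHAR('a) ^ n) = of_int x"
proof -
  define y where "y = nat (x mod int CHAR('a))"
  have "CHAR('a) > 0" using assms by (rule prime_gt_0_nat)
  then have "(of_int x :: 'a) = of_int (int y)"
    unfolding of_int_eq_iff_cong_CHAR by (simp add: y_def cong_def)
  then have y: "(of_int x :: 'a) = (\<Sum>i<y. 1)" by simp
  show ?thesis unfolding y by (subst freshmans_dream_sum'[OF assms refl]) simp
qed

section \<open>The field generated by a root of unity of prime order\<close>

locale prime_cyclotomic_field =
  fixes p r :: nat and \<zeta> :: "'a::{field, finite}"
  assumes p: "prime p" and r: "prime r" "odd r" and primroot: "residue_primroot r p"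
    and card_field: "card (UNIV :: 'a set) = p ^ (r - 1)"
    and root: "\<zeta> ^ r = 1" "\<zeta> \<noteq> 1"
begin

lemma char_field: "CHAR('a) = p"
  using CHAR_eq_of_card_prime_power[OF p card_field] .

lemma inj_root_powers: "inj_on (\<lambda>i. \<zeta> ^ i) {..<r}"
proof (rule linorder_inj_onI)
  fix i j assume ij: "i < j" "i \<in> {..<r}" "j \<in> {..<r}"
  show "\<zeta> ^ i \<noteq> \<zeta> ^ j"
  proof
    assume "\<zeta> ^ i = \<zeta> ^ j"
    also have "\<zeta> ^ j = \<zeta> ^ i * \<zeta> ^ (j - i)" using ij by (simp flip: power_add)
    finally have "\<zeta> ^ (j - i) = 1" using root r by (auto simp: power_0_left)
    then have "r dvd j - i" using nontrivial_root_power_eq_one r root by blast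
    then show False using ij by (auto dest: dvd_imp_le)
  qed
qed auto

text \<open>The coefficients are integers rather than field elements because their absolute values
  will count summands.\<close>

definition comb :: "(nat \<Rightarrow> int) \<Rightarrow> 'a" where
  "comb a = (\<Sum>i<r. of_int (a i) * \<zeta> ^ i)"

lemma comb_add: "comb (\<lambda>i. a i + b i) = comb a + comb b"
  by (simp add: comb_def algebra_simps sum.distrib)

lemma comb_diff: "comb (\<lambda>i. a i - b i) = comb a - comb b"
  by (simp add: comb_def algebra_simps sum_subtractf)

lemma comb_single: "i < r \<Longrightarrow> comb (\<lambda>j. if j = i then e else 0) = of_int e * \<zeta> ^ i"
  by (simp add: comb_def if_distrib[of of_int] if_distrib[of "\<lambda>x. x * _"] cong: if_cong)

lemma sum_root_powers:
  assumes "0 < j" "j < r"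
  shows "(\<Sum>i<r. (\<zeta> ^ j) ^ i) = 0"
proof -
  have "\<not> r dvd j" using assms by (auto dest: dvd_imp_le)
  then have "\<zeta> ^ j \<noteq> 1" using nontrivial_root_power_eq_one r root by blast
  moreover have "(\<zeta> ^ j) ^ r = 1"
    by (metis root(1) power_mult mult.commute power_one)
  ultimately show ?thesis using geometric_sum[of "\<zeta> ^ j" r] by simp
qed

text \<open>
  By Frobenius, a relation over the prime field that holds at \<open>\<zeta>\<close> holds at all \<open>\<zeta> ^ (p ^ n)\<close>,
  that is, at every nontrivial power of \<open>\<zeta>\<close>, because \<open>p\<close> is a primitive root modulo \<open>r\<close>.
\<close>
lemma comb_conjugate:
  assumes "comb a = 0" "0 < j" "j < r"
  shows "(\<Sum>i<r. of_int (a i) * (\<zeta> ^ j) ^ i) = 0"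
proof -
  have "j \<in> totatives r" using assms by (simp add: totatives_prime r)
  then obtain n where n: "j = p ^ n mod r"
    using residue_primroot_is_generator[OF prime_gt_1_nat[OF r(1)] primroot]
    by (auto simp: bij_betw_def)
  have char: "prime CHAR('a)" by (simp add: char_field p)
  have "(\<Sum>i<r. of_int (a i) * (\<zeta> ^ j) ^ i) = (\<Sum>i<r. (of_int (a i) * \<zeta> ^ i) ^ (p ^ n))"
  proof (intro sum.cong refl)
    fix i
    have "\<zeta> ^ j = \<zeta> ^ (p ^ n)" using power_mod_exponent[OF root(1), of "p ^ n"] n by simp
    then show "of_int (a i) * (\<zeta> ^ j) ^ i = (of_int (a i) * \<zeta> ^ i) ^ (p ^ n)"
      using of_int_power_CHAR_power[OF char, of "a i" n]
      by (simp add: char_field power_mult_distrib power_mult[symmetric] mult.commute)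
  qed
  also have "\<dots> = comb a ^ (p ^ n)"
    unfolding comb_def using freshmans_dream_sum'[OF char refl, of _ "{..<r}" n]
    by (simp add: char_field)
  finally show ?thesis using assms p by (simp add: prime_gt_0_nat)
qed

text \<open>As the powers of \<open>\<zeta>\<close> sum to 0, the last coefficient can be subtracted
  from all. This leaves a polynomial of degree below \<open>r - 1\<close> that vanishes at the
  \<open>r - 1\<close> nontrivial powers of \<open>\<zeta>\<close>, so it is 0.\<close>

lemma comb_eq_0D:
  assumes "comb a = 0" "i < r"
  shows "[a i = a (r - 1)] (mod int p)"
proof (cases "i = r - 1")
  case False
  then have i: "i < r - 1" using \<open>i < r\<close> by simp
  define c where "c = (of_int (a (r - 1)) :: 'a)"
  define Q where "Q = (\<Sum>i<r - 1. Polynomial.monom (of_int (a i) - c) i)"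
  have r_Suc: "r = Suc (r - 1)" using r(1) by (simp add: prime_gt_0_nat)
  have "poly Q z = poly 0 z" if z: "z \<in> (\<lambda>j. \<zeta> ^ j) ` {1..<r}" for z
  proof -
    obtain j where j: "z = \<zeta> ^ j" "0 < j" "j < r" using z by auto
    have "poly Q z = (\<Sum>i<r - 1. (of_int (a i) - c) * z ^ i)"
      by (simp add: Q_def poly_sum poly_monom)
    also have "\<dots> = (\<Sum>i<r. (of_int (a i) - c) * z ^ i)"
      by (subst (2) r_Suc) (simp add: c_def)
    also have "\<dots> = (\<Sum>i<r. of_int (a i) * z ^ i) - c * (\<Sum>i<r. z ^ i)"
      by (simp add: algebra_simps sum_subtractf sum_distrib_left)
    also have "\<dots> = 0"
      using comb_conjugate[OF assms(1)] sum_root_powers j by simp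
    finally show ?thesis by simp
  qed
  moreover have "card ((\<lambda>j. \<zeta> ^ j) ` {1..<r}) = r - 1"
    using inj_root_powers by (subst card_image) (auto intro: inj_on_subset)
  moreover have "Polynomial.degree Q < r - 1"
    unfolding Q_def using i
    by (intro degree_sum_less) (auto intro: le_less_trans[OF degree_monom_le])
  ultimately have "Q = 0" using i by (intro poly_eqI_degree[of "(\<lambda>j. \<zeta> ^ j) ` {1..<r}"]) auto
  then have "Polynomial.coeff Q i = 0" by simp
  then have "(of_int (a i) :: 'a) = c" using i by (simp add: Q_def coeff_sum)
  then show ?thesis by (simp add: c_def of_int_eq_iff_cong_CHAR char_field)
qed auto

lemma comb_eqD:
  assumes "comb a = comb b"
  shows "\<exists>c. \<forall>i<r. [b i = a i - c] (mod int p)"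
proof -
  have "comb (\<lambda>i. a i - b i) = 0" using assms by (simp add: comb_diff)
  then have "[a i - b i = a (r - 1) - b (r - 1)] (mod int p)" if "i < r" for i
    using comb_eq_0D that by blast
  moreover have "[b i = a i - d] (mod int p)" if "[a i - b i = d] (mod int p)" for i d
  proof -
    have "b i - (a i - d) = - (a i - b i - d)" by simp
    then show ?thesis using that unfolding cong_iff_dvd_diff by (metis dvd_minus_iff)
  qed
  ultimately have "\<forall>i<r. [b i = a i - (a (r - 1) - b (r - 1))] (mod int p)" by blast
  then show ?thesis by blast
qed

lemma comb_eqI:
  assumes "\<And>i. i < r \<Longrightarrow> [b i = a i - c] (mod int p)"
  shows "comb b = comb a"
proof -
  have "comb b = (\<Sum>i<r. of_int (a i - c) * \<zeta> ^ i)"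
    unfolding comb_def using assms
    by (intro sum.cong refl arg_cong2[of _ _ _ _ "(*)"]) (auto simp only: of_int_eq_iff_cong_CHAR char_field lessThan_iff)
  also have "\<dots> = comb a - of_int c * (\<Sum>i<r. \<zeta> ^ i)"
    by (simp add: comb_def algebra_simps sum_subtractf sum_distrib_left)
  also have "(\<Sum>i<r. \<zeta> ^ i) = 0" using sum_root_powers[of 1] prime_gt_1_nat[OF r(1)] by simp
  finally show ?thesis by simp
qed

text \<open>By \<open>comb_eq_0D\<close>, coefficients in \<open>0, ..., p - 1\<close> with last
  coefficient 0 give distinct elements, and there are \<open>p ^ (r - 1)\<close> such
  choices.\<close>

lemma comb_surj: obtains a where "x = comb a"
proof -
  define F where "F = PiE {..<r - 1} (\<lambda>_. {..<p})"
  define \<Phi> where "\<Phi> = (\<lambda>f :: nat \<Rightarrow> nat. comb (\<lambda>i. if i < r - 1 then int (f i) else 0))"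
  have "inj_on \<Phi> F"
  proof (rule inj_onI)
    fix f g assume fg: "f \<in> F" "g \<in> F" "\<Phi> f = \<Phi> g"
    let ?d = "\<lambda>i. (if i < r - 1 then int (f i) else 0) - (if i < r - 1 then int (g i) else 0)"
    have d: "comb ?d = 0" using fg(3) by (simp add: comb_diff \<Phi>_def)
    show "f = g"
    proof (rule PiE_ext)
      show "f \<in> PiE {..<r - 1} (\<lambda>_. {..<p})" "g \<in> PiE {..<r - 1} (\<lambda>_. {..<p})"
        using fg by (simp_all add: F_def)
      fix i assume i: "i \<in> {..<r - 1}"
      then have "[int (f i) - int (g i) = 0] (mod int p)"
        using comb_eq_0D[OF d, of i] by simp
      then have "[f i = g i] (mod p)" by (simp add: cong_diff_iff_cong_0 cong_int_iff)
      moreover have "f i < p" "g i < p" using fg i by (auto simp: F_def)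
      ultimately show "f i = g i" by (simp add: cong_def)
    qed
  qed
  then have "card (\<Phi> ` F) = card (UNIV :: 'a set)"
    by (simp add: card_image F_def card_PiE card_field)
  then have "\<Phi> ` F = UNIV" by (intro card_subset_eq) auto
  then obtain f where "x = \<Phi> f" by blast
  then show thesis using that by (simp add: \<Phi>_def)
qed

end

section \<open>Sums of powers\<close>

definition power_sums :: "nat \<Rightarrow> nat \<Rightarrow> 'a::field set" where
  "power_sums k g = range (\<lambda>x :: nat \<Rightarrow> 'a. \<Sum>i=1..g. x i ^ k)"

lemma all_sums_of_powers_iff: "all_sums_of_powers TYPE('a::field) k g \<longleftrightarrow> (power_sums k g :: 'a set) = UNIV"
  by (auto simp: all_sums_of_powers_def power_sums_def image_iff)

lemma power_sums_0: "power_sums k 0 = {0}"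
  by (simp add: power_sums_def)

lemma power_sums_Suc: "power_sums k (Suc g) = {y + x ^ k | x y. y \<in> power_sums k g}"
proof (intro equalityI subsetI)
  fix z :: 'a assume "z \<in> {y + x ^ k | x y. y \<in> power_sums k g}"
  then obtain x and f :: "nat \<Rightarrow> 'a" where "z = (\<Sum>i=1..g. f i ^ k) + x ^ k"
    by (auto simp: power_sums_def)
  then have "z = (\<Sum>i=1..Suc g. (f(Suc g := x)) i ^ k)" by simp
  then show "z \<in> power_sums k (Suc g)" unfolding power_sums_def by blast
qed (auto simp: power_sums_def)

lemma power_sums_mono:
  assumes "k > 0" "y \<in> power_sums k m" "m \<le> n"
  shows "y \<in> power_sums k n"
  using assms(3,2)
proof (induction rule: dec_induct)
  case (step n)
  then have "y + 0 ^ k \<in> power_sums k (Suc n)" unfolding power_sums_Suc by blast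
  then show ?case using \<open>k > 0\<close> by (simp add: zero_power)
qed

lemma power_sums_add:
  assumes "y \<in> power_sums k m" "z \<in> power_sums k n"
  shows "y + z \<in> power_sums k (m + n)"
  using assms(2)
proof (induction n arbitrary: z)
  case (Suc n)
  then obtain x z' where "z = z' + x ^ k" "z' \<in> power_sums k n" by (auto simp: power_sums_Suc)
  then have "z = z' + x ^ k" "y + z' \<in> power_sums k (m + n)" using Suc.IH by auto
  then show ?case by (auto simp: power_sums_Suc simp flip: add.assoc)
qed (use assms(1) in \<open>simp add: power_sums_0\<close>)

lemma power_sums_sum:
  assumes "finite A" "\<And>i. i \<in> A \<Longrightarrow> f i \<in> power_sums k (n i)"
  shows "sum f A \<in> power_sums k (sum n A)"
  using assms by (induction A rule: finite_induct) (auto simp: power_sums_0 intro: power_sums_add)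

lemma of_nat_mult_power_in_power_sums: "of_nat n * x ^ k \<in> power_sums k n"
proof (induction n)
  case (Suc n)
  have "of_nat n * x ^ k + x ^ k \<in> power_sums k (Suc n)" using Suc by (auto simp: power_sums_Suc)
  then show ?case by (simp add: algebra_simps)
qed (simp add: power_sums_0)

context prime_cyclotomic_field
begin

text \<open>A nonzero \<open>k\<close>-th power is \<open>\<zeta> ^ i\<close> up to sign, so each
  summand changes one coefficient by at most 1. The bound is an inequality because 0 is a
  \<open>k\<close>-th power too.\<close>

lemma power_sums_eq_small_combs:
  assumes "k > 0" and card: "p ^ (r - 1) - 1 = 2 * r * k"
  shows "power_sums k g = {comb b | b. (\<Sum>i<r. \<bar>b i\<bar>) \<le> int g}"
proof (intro equalityI subsetI)
  have powers: "(\<lambda>x :: 'a. x ^ k) ` (UNIV - {0}) = {z. z ^ (2 * r) = 1}"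
    using assms prime_gt_0_nat[OF r(1)] by (intro finite_field_powers) (auto simp: card_field)
  have roots: "{z. z ^ r = 1} = (\<lambda>i. \<zeta> ^ i) ` {..<r}"
  proof (rule card_seteq[symmetric])
    show "(\<lambda>i. \<zeta> ^ i) ` {..<r} \<subseteq> {z. z ^ r = 1}"
      using root by (auto simp: power_mult[symmetric] mult.commute[of _ r]) (simp add: power_mult)
    show "card {z :: 'a. z ^ r = 1} \<le> card ((\<lambda>i. \<zeta> ^ i) ` {..<r})"
      using card_nth_roots_le[of r "1 :: 'a"] r(1) by (simp add: card_image inj_root_powers prime_gt_0_nat)
  qed simp
  have comb_power: "\<exists>e i. \<bar>e\<bar> \<le> 1 \<and> i < r \<and> x ^ k = of_int e * \<zeta> ^ i" for x
  proof (cases "x = 0")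
    case True
    then show ?thesis using \<open>k > 0\<close> prime_gt_0_nat[OF r(1)] by (intro exI[of _ 0]) auto
  next
    case False
    then have "(x ^ k) ^ (2 * r) = 1" using powers by blast
    then have "((x ^ k) ^ r) ^ 2 = 1" by (simp only: power_mult[symmetric] ac_simps)
    \<comment> \<open>As \<open>r\<close> is odd, a sign can be absorbed: the negative of an
      \<open>r\<close>-th root of -1 is an \<open>r\<close>-th root of unity.\<close>
    then have "(x ^ k) ^ r = 1 \<or> (- (x ^ k)) ^ r = 1"
      using r(2) by (auto simp: power2_eq_1_iff power_minus_odd)
    then have "x ^ k \<in> (\<lambda>i. \<zeta> ^ i) ` {..<r} \<or> - (x ^ k) \<in> (\<lambda>i. \<zeta> ^ i) ` {..<r}"
      using roots by blast
    then show ?thesis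
    proof
      assume "x ^ k \<in> (\<lambda>i. \<zeta> ^ i) ` {..<r}"
      then obtain i where "i < r" "x ^ k = \<zeta> ^ i" by blast
      then show ?thesis by (intro exI[of _ 1] exI[of _ i]) auto
    next
      assume "- (x ^ k) \<in> (\<lambda>i. \<zeta> ^ i) ` {..<r}"
      then obtain i where "i < r" "- (x ^ k) = \<zeta> ^ i" by blast
      then show ?thesis
        by (intro exI[of _ "-1"] exI[of _ i]) (simp add: minus_equation_iff[of "x ^ k"])
    qed
  qed
  {
    fix y :: 'a assume "y \<in> power_sums k g"
    then show "y \<in> {comb b | b. (\<Sum>i<r. \<bar>b i\<bar>) \<le> int g}"
    proof (induction g arbitrary: y)
      case 0
      then show ?case by (auto simp: power_sums_0 comb_def intro!: exI[of _ "\<lambda>_. 0"])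
    next
      case (Suc g)
      then obtain x y' where y: "y = y' + x ^ k" "y' \<in> power_sums k g"
        by (auto simp: power_sums_Suc)
      then obtain b where b: "y' = comb b" "(\<Sum>i<r. \<bar>b i\<bar>) \<le> int g" using Suc.IH by blast
      obtain e i where e: "\<bar>e\<bar> \<le> 1" "i < r" "x ^ k = of_int e * \<zeta> ^ i" using comb_power by blast
      let ?d = "\<lambda>j. if j = i then e else 0"
      have "y = comb (\<lambda>j. b j + ?d j)" unfolding comb_add using y b e by (simp add: comb_single)
      moreover have "(\<Sum>j<r. \<bar>b j + ?d j\<bar>) \<le> (\<Sum>j<r. \<bar>b j\<bar> + (if j = i then \<bar>e\<bar> else 0))"
        by (intro sum_mono) auto
      then have "(\<Sum>j<r. \<bar>b j + ?d j\<bar>) \<le> int (Suc g)" using b e by (simp add: sum.distrib)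
      ultimately show ?case by blast
    qed
  next
    fix y assume "y \<in> {comb b | b. (\<Sum>i<r. \<bar>b i\<bar>) \<le> int g}"
    then obtain b where b: "y = comb b" "(\<Sum>i<r. \<bar>b i\<bar>) \<le> int g" by blast
    have "of_int (b i) * \<zeta> ^ i \<in> power_sums k (nat \<bar>b i\<bar>)" if "i < r" for i
    proof -
      let ?z = "of_int (sgn (b i)) * \<zeta> ^ i"
      show ?thesis
      proof (cases "b i = 0")
        case False
        then have "sgn (b i) = 1 \<or> sgn (b i) = -1" by (simp add: sgn_if)
        then have "(of_int (sgn (b i)) :: 'a) ^ (2 * r) = 1" by (auto simp: power_mult)
        moreover have "(\<zeta> ^ i) ^ (2 * r) = (\<zeta> ^ r) ^ (2 * i)"
          by (simp only: power_mult[symmetric] ac_simps)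
        ultimately have "?z ^ (2 * r) = 1" using root by (simp only: power_mult_distrib power_one mult_1)
        then obtain x where "?z = x ^ k" using powers by blast
        moreover have "of_int (b i) * \<zeta> ^ i = of_nat (nat \<bar>b i\<bar>) * ?z"
        proof -
          have "(of_int (b i) :: 'a) = of_int (\<bar>b i\<bar> * sgn (b i))" by (simp only: abs_mult_sgn)
          also have "\<dots> = of_nat (nat \<bar>b i\<bar>) * of_int (sgn (b i))" by (simp add: of_nat_nat)
          finally show ?thesis by (simp only: mult.assoc)
        qed
        ultimately show ?thesis using of_nat_mult_power_in_power_sums[of "nat \<bar>b i\<bar>" x k] by simp
      qed (simp add: power_sums_0)
    qed
    then have "y \<in> power_sums k (\<Sum>i<r. nat \<bar>b i\<bar>)"
      unfolding b(1) comb_def by (intro power_sums_sum) auto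
    moreover have "(\<Sum>i<r. nat \<bar>b i\<bar>) \<le> g"
      using b(2) by (simp flip: zle_int)
    ultimately show "y \<in> power_sums k g" using power_sums_mono \<open>k > 0\<close> by blast
  }
qed

text \<open>Coefficient vectors of one element differ by a common shift \<open>c\<close> modulo
  \<open>p\<close>. For fixed \<open>c\<close> the cheapest representatives have absolute values
  \<open>cyc_norm p (a i - c)\<close>, so the minimum of the distance sums over \<open>c\<close> is
  the number of summands needed.\<close>

lemma power_sums_eq_UNIV_iff:
  assumes "k > 0" and card: "p ^ (r - 1) - 1 = 2 * r * k"
  shows "(power_sums k g :: 'a set) = UNIV \<longleftrightarrow> (\<forall>a. \<exists>c. cyc_dist_sum p r a c \<le> int g)"
proof (intro iffI allI)
  have "p > 0" using p by (rule prime_gt_0_nat)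
  {
    fix a assume "(power_sums k g :: 'a set) = UNIV"
    then have "comb a \<in> power_sums k g" by simp
    then obtain b where b: "comb a = comb b" "(\<Sum>i<r. \<bar>b i\<bar>) \<le> int g"
      unfolding power_sums_eq_small_combs[OF assms] by blast
    obtain c where c: "\<And>i. i < r \<Longrightarrow> [b i = a i - c] (mod int p)" using comb_eqD[OF b(1)] by blast
    have "cyc_dist_sum p r a c = (\<Sum>i<r. cyc_norm p (b i))"
      unfolding cyc_dist_sum_def using c by (intro sum.cong refl cyc_norm_cong) (simp add: cong_def)
    also have "\<dots> \<le> (\<Sum>i<r. \<bar>b i\<bar>)" using \<open>p > 0\<close> by (intro sum_mono cyc_norm_le_abs)
    finally show "\<exists>c. cyc_dist_sum p r a c \<le> int g" using b(2) by (intro exI[of _ c]) simp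
  next
    assume *: "\<forall>a. \<exists>c. cyc_dist_sum p r a c \<le> int g"
    have "x \<in> power_sums k g" for x :: 'a
    proof -
      obtain a where a: "x = comb a" using comb_surj .
      obtain c where c: "cyc_dist_sum p r a c \<le> int g" using * by blast
      have "\<forall>i. \<exists>y. y mod int p = (a i - c) mod int p \<and> \<bar>y\<bar> = cyc_norm p (a i - c)"
        using cyc_norm_attained[OF \<open>p > 0\<close>] by metis
      then obtain b where b: "\<And>i. b i mod int p = (a i - c) mod int p"
        "\<And>i. \<bar>b i\<bar> = cyc_norm p (a i - c)" by metis
      have "comb b = x" unfolding a by (rule comb_eqI[of _ _ c]) (simp add: cong_def b)
      moreover have "(\<Sum>i<r. \<bar>b i\<bar>) \<le> int g" using c by (simp add: b(2) cyc_dist_sum_def)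
      ultimately show ?thesis unfolding power_sums_eq_small_combs[OF assms] by blast
    qed
    then show "(power_sums k g :: 'a set) = UNIV" by blast
  }
qed

end


section \<open>The Waring number\<close>

lemma waring_eqI:
  assumes "g > 0" "all_sums_of_powers TYPE('a::{field, finite}) k g"
    and "\<And>g'. all_sums_of_powers TYPE('a) k g' \<Longrightarrow> g \<le> g'"
  shows "waring TYPE('a) k = g"
  unfolding waring_def using assms by (intro Least_equality) auto

text \<open>The smaller of the two averages, rounded down: \<open>p * r / 4 - p / (4 * r)\<close> is
  below \<open>p * r / 4 - r / (4 * p)\<close> exactly if \<open>r < p\<close>.\<close>

definition cyc_median_bound :: "nat \<Rightarrow> nat \<Rightarrow> int" where
  "cyc_median_bound p r = (if r < p then int p * (int r ^ 2 - 1) div (4 * int r)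
    else int r * (int p ^ 2 - 1) div (4 * int p))"

lemma cyc_median_le_bound:
  assumes "odd p" "odd r"
  shows "\<exists>c. cyc_dist_sum p r a c \<le> cyc_median_bound p r"
proof -
  have div: "x \<le> N div d" if "d * x \<le> N" "d > 0" for x N d :: int
    using zdiv_mono1[OF that] that(2) by simp
  have "0 < p" "0 < r" using assms by (simp_all add: odd_pos)
  obtain c where c: "4 * int r * cyc_dist_sum p r a c \<le> int p * (int r ^ 2 - 1)"
    using cyc_median_le_mean_at_points[OF assms] by blast
  obtain d where d: "4 * int p * cyc_dist_sum p r a d \<le> int r * (int p ^ 2 - 1)"
    using cyc_median_le_mean[OF assms(1)] by blast
  show ?thesis
    using div[OF c] div[OF d] \<open>0 < p\<close> \<open>0 < r\<close> by (auto simp: cyc_median_bound_def)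
qed

lemma cyc_median_bound_attained:
  assumes "odd p" "odd r" "p \<noteq> r"
  shows "\<exists>a. \<forall>c. cyc_median_bound p r \<le> cyc_dist_sum p r a c"
proof (cases "r < p")
  case True
  show ?thesis
    by (rule cyc_dist_sum_lower_fewer_points[OF assms(1,2) True])
      (use True in \<open>auto simp: cyc_median_bound_def\<close>)
next
  case False
  then have "p < r" using assms by simp
  show ?thesis
    by (rule cyc_dist_sum_lower_more_points[OF assms(1,2) \<open>p < r\<close>])
      (use False in \<open>auto simp: cyc_median_bound_def\<close>)
qed

text \<open>The Waring number is a least positive number, so its claimed value has to be
  positive.\<close>

lemma cyc_median_bound_pos:
  assumes "p \<ge> 3" "r \<ge> 3"
  shows "cyc_median_bound p r > 0"
proof -
  have "x * (y ^ 2 - 1) div (4 * y) > 0" if "x \<ge> 3" "y \<ge> 3" for x y :: int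
  proof -
    have "3 * (y ^ 2 - 1) \<le> x * (y ^ 2 - 1)"
      using that by (intro mult_right_mono) auto
    moreover have "3 * y \<le> y ^ 2" using that by (simp add: power2_eq_square)
    then have "4 * y \<le> 3 * (y ^ 2 - 1)" using that by simp
    ultimately have "4 * y \<le> x * (y ^ 2 - 1)" by (rule order_trans[rotated])
    then show ?thesis using that by (simp add: pos_imp_zdiv_pos_iff)
  qed
  then show ?thesis using assms by (simp add: cyc_median_bound_def)
qed

lemma floor_eq_cyc_median_bound:
  assumes "p > 0" "r > 0"
  shows "(if r < p then \<lfloor>real p * real r / 4 - real p / (4 * real r)\<rfloor>
    else \<lfloor>real p * real r / 4 - real r / (4 * real p)\<rfloor>) = cyc_median_bound p r"
proof -
  have "\<lfloor>real x * real y / 4 - real x / (4 * real y)\<rfloor> = int x * (int y ^ 2 - 1) div (4 * int y)"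
    if "y > 0" for x y :: nat
  proof -
    have "real x * real y / 4 - real x / (4 * real y)
        = real_of_int (int x * (int y ^ 2 - 1)) / real_of_int (4 * int y)"
      using that by (simp add: field_simps power2_eq_square)
    then show ?thesis by (simp only: floor_divide_of_int_eq)
  qed
  from this[of r p] this[of p r] show ?thesis using assms
    by (simp add: cyc_median_bound_def mult.commute)
qed

text \<open>Of the \<open>2 * r\<close> solutions of \<open>z ^ (2 * r) = 1\<close> at most 2
  satisfy \<open>z ^ 2 = 1\<close>; the square of any other one is a nontrivial \<open>r\<close>-th
  root of unity.\<close>

lemma primitive_root_of_unity_exists:
  assumes "card (UNIV :: 'a::{field, finite} set) - 1 = 2 * r * k" "r > 1" "k > 0"
  obtains \<zeta> :: "'a::{field, finite}" where "\<zeta> ^ r = 1" "\<zeta> \<noteq> 1"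
proof -
  have "card {z :: 'a. z ^ 2 = 1} < card {z :: 'a. z ^ (2 * r) = 1}"
    using finite_field_powers(2)[OF assms(1)] assms card_nth_roots_le[of 2 "1 :: 'a"] by simp
  then have "\<not> {z :: 'a. z ^ (2 * r) = 1} \<subseteq> {z. z ^ 2 = 1}"
    by (metis card_mono finite not_le)
  then obtain z :: 'a where "z ^ (2 * r) = 1" "z ^ 2 \<noteq> 1" by blast
  then show thesis using that[of "z ^ 2"] by (simp add: power_mult)
qed

lemma double_prime_dvd_power_minus_one:
  assumes "odd p" "prime r" "odd r" "\<not> r dvd p"
  shows "2 * r dvd p ^ (r - 1) - (1 :: nat)"
proof (rule divides_mult)
  show "2 dvd p ^ (r - 1) - 1" using \<open>odd p\<close> by simp
  have "[p ^ (r - 1) = 1] (mod r)" using assms by (intro fermat_theorem) auto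
  then show "r dvd p ^ (r - 1) - 1" by (metis cong_to_1_nat)
  show "coprime 2 r" using \<open>odd r\<close> by simp
qed

theorem theorem1p3:
  fixes p r :: nat
  assumes "prime p" and "odd p"
    and "prime r" and "odd r"
    and "residue_primroot r p"
    and "card (UNIV :: 'a::{field, finite} set) = p ^ (r - 1)"
  shows "(\<exists>g>0. all_sums_of_powers TYPE('a) ((p ^ (r - 1) - 1) div (2 * r)) g) \<and>
    int (waring TYPE('a) ((p ^ (r - 1) - 1) div (2 * r))) =
      (if r < p then \<lfloor>real p * real r / 4 - real p / (4 * real r)\<rfloor>
       else \<lfloor>real p * real r / 4 - real r / (4 * real p)\<rfloor>)"
proof -
  let ?k = "(p ^ (r - 1) - 1) div (2 * r)"
  define g where "g = nat (cyc_median_bound p r)"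
  have gt: "p \<ge> 3" "r \<ge> 3"
    using prime_ge_2_nat[OF assms(1)] prime_ge_2_nat[OF assms(3)] assms(2,4) by presburger+
  then have g: "g > 0" "int g = cyc_median_bound p r"
    using cyc_median_bound_pos by (simp_all add: g_def order_less_imp_le)
  \<comment> \<open>Being a unit modulo \<open>r\<close>, \<open>p\<close> differs from
    \<open>r\<close>, so the second case of the formula means \<open>p < r\<close>.\<close>
  have "coprime r p" using assms(5) by (simp add: residue_primroot_def)
  then have ndvd: "\<not> r dvd p" using coprime_common_divisor[of r p r] gt by auto
  then have "p \<noteq> r" by auto
  have k: "p ^ (r - 1) - 1 = 2 * r * ?k"
    using double_prime_dvd_power_minus_one[OF assms(2-4) ndvd] by simp
  moreover have "1 < p ^ (r - 1)" using gt by (intro one_less_power) auto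
  ultimately have "?k > 0" by (metis bot_nat_0.not_eq_extremum mult_0_right zero_less_diff)
  obtain \<zeta> :: 'a where "\<zeta> ^ r = 1" "\<zeta> \<noteq> 1"
    using primitive_root_of_unity_exists[where ?'a = 'a, of r ?k] k gt \<open>?k > 0\<close> by (auto simp: assms(6))
  then interpret prime_cyclotomic_field p r \<zeta>
    using assms by unfold_locales auto
  note iff = power_sums_eq_UNIV_iff[OF \<open>?k > 0\<close> k, folded all_sums_of_powers_iff]
  have "all_sums_of_powers TYPE('a) ?k g"
    unfolding iff g(2) using cyc_median_le_bound[OF assms(2,4)] by blast
  moreover have "g \<le> g'" if "all_sums_of_powers TYPE('a) ?k g'" for g'
  proof -
    obtain a where a: "\<forall>c. cyc_median_bound p r \<le> cyc_dist_sum p r a c"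
      using cyc_median_bound_attained[OF assms(2,4) \<open>p \<noteq> r\<close>] by blast
    obtain c where "cyc_dist_sum p r a c \<le> int g'" using \<open>all_sums_of_powers TYPE('a) ?k g'\<close> iff by blast
    with a have "int g \<le> int g'" unfolding g(2) by (meson order_trans)
    then show ?thesis by simp
  qed
  ultimately have "waring TYPE('a) ?k = g" using g(1) by (intro waring_eqI)
  then show ?thesis
    using \<open>all_sums_of_powers TYPE('a) ?k g\<close> g floor_eq_cyc_median_bound[of p r] gt by auto
qed

end
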